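(* Let $(L,[-,-,-]_L)$ and $(H,[-,-,-]_H)$ be 3-Lie algebras over a field $\mathbb{K}$ of characteristic $0$, let $\rho:\wedge^2L\to\mathrm{End}(H)$ be a coherent action of $L$ on $H$, and let $\Lambda:H\to L$ be a nonabelian embedding tensor on $L$ with respect to this coherent action. Then there is a bijection between the set of all equivalence classes of infinitesimal deformations of $\Lambda$ and the first cohomology group $\mathcal{H}^1_\Lambda(H,L)$.
   Context: All vector spaces are over a field $\mathbb{K}$ of characteristic $0$. A 3-Lie algebra $(L,[-,-,-]_L)$ is a vector space $L$ with a skew-symmetric trilinear map $[-,-,-]_L:\wedge^3L\to L$ such that for all $l_i\in L$ $$[l_1,l_2,[l_3,l_4,l_5]_L]_L=[[l_1,l_2,l_3]_L,l_4,l_5]_L+[l_3,[l_1,l_2,l_4]_L,l_5]_L+[l_3,l_4,[l_1,l_2,l_5]_L]_L.$$ A coherent action of a 3-Lie algebra $L$ on a 3-Lie algebra $H$ is a linear map $\rho:\wedge^2L\to\mathrm{End}(H)$ such that for all $l_i\in L$, $h_i\in H$: $$\rho([l_1,l_2,l_3]_L,l_4)=\rho(l_2,l_3)\rho(l_1,l_4)+\rho(l_3,l_1)\rho(l_2,l_4)+\rho(l_1,l_2)\rho(l_3,l_4),$$ $$\rho(l_1,l_2)\rho(l_3,l_4)=\rho(l_3,l_4)\rho(l_1,l_2)+\rho([l_1,l_2,l_3]_L,l_4)+\rho(l_3,[l_1,l_2,l_4]_L),$$ $$\rho(l_1,l_2)[h_1,h_2,h_3]_H=[\rho(l_1,l_2)h_1,h_2,h_3]_H+[h_1,\rho(l_1,l_2)h_2,h_3]_H+[h_1,h_2,\rho(l_1,l_2)h_3]_H,$$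 $$[\rho(l_1,l_2)h_1,h_2,h_3]_H=0.$$ A nonabelian embedding tensor on $L$ with respect to the coherent action is a linear map $\Lambda:H\to L$ with $[\Lambda h_1,\Lambda h_2,\Lambda h_3]_L=\Lambda(\rho(\Lambda h_1,\Lambda h_2)h_3+[h_1,h_2,h_3]_H)$ for all $h_i\in H$. First cohomology group. Put $[h_1,h_2,h_3]_\Lambda=\rho(\Lambda h_1,\Lambda h_2)h_3+[h_1,h_2,h_3]_H$. For $\phi\in\mathrm{Hom}(H,L)$ and $u,v,w\in H$ let $$(\delta_\Lambda\phi)(u,v,w)=-\phi([u,v,w]_\Lambda)+[\Lambda u,\Lambda v,\phi(w)]_L+[\Lambda u,\phi(v),\Lambda w]_L-\Lambda\rho(\Lambda u,\phi(v))w+[\phi(u),\Lambda v,\Lambda w]_L-\Lambda\rho(\phi(u),\Lambda v)w.$$ Let $\delta_\Lambda:\wedge^2L\to\mathrm{Hom}(H,L)$ be the linear map determined by $\delta_\Lambda(a_1\wedge a_2)u=\Lambda\rho(a_1,a_2)u-[a_1,a_2,\Lambda u]_L$. Then $\mathcal{Z}^1_\Lambda(H,L)=\{\phi\in\mathrm{Hom}(H,L):\delta_\Lambda\phi=0\}$, $\mathcal{B}^1_\Lambda(H,L)=\delta_\Lambda(\wedge^2L)$, and $\mathcal{H}^1_\Lambda(H,L)=\mathcal{Z}^1_\Lambda(H,L)/\mathcal{B}^1_\Lambda(H,L)$. Infinitesimal deformations. Let $t$ be a parameter with $t^2=0$; all structures are extended $\mathbb{K}[t]/(t^2)$-linearly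 and all identities are understood modulo $t^2$. An infinitesimal deformation of $\Lambda$ is a nonabelian embedding tensor of the form $\Lambda_t=\Lambda+t\Lambda_1$ with $\Lambda_1\in\mathrm{Hom}(H,L)$, i.e. $[\Lambda_tu_1,\Lambda_tu_2,\Lambda_tu_3]_L=\Lambda_t\rho(\Lambda_tu_1,\Lambda_tu_2)u_3+\Lambda_t[u_1,u_2,u_3]_H$ for all $u_i\in H$. For $X\in\wedge^2L$, let $ad(X)\in\mathrm{End}(L)$ and $\rho(X)\in\mathrm{End}(H)$ be given by linear extension of $ad(a_1\wedge a_2)(l)=[a_1,a_2,l]_L$ and $\rho(a_1\wedge a_2)=\rho(a_1,a_2)$. Two infinitesimal deformations $\Lambda_t=\Lambda+t\Lambda_1$ and $\Lambda'_t=\Lambda+t\Lambda'_1$ are equivalent if there exists $X\in\wedge^2L$ such that, with $f_L=\mathrm{id}_L+t\,ad(X)$ and $f_H=\mathrm{id}_H+t\rho(X)$: (i) $f_L$ and $f_H$ are 3-Lie algebra homomorphisms (preserve the ternary brackets); (ii) $f_H(\rho(a,b)u)=\rho(f_L(a),f_L(b))f_H(u)$ for all $a,b\in L$, $u\in H$; (iii) $\Lambda'_t\circ f_H=f_L\circ\Lambda_t$. *)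

theory Defs
  imports Complex_Main "HOL-Library.Poly_Mapping" "HOL-Library.Product_Plus"
begin

section \<open>3-Lie algebras, coherent actions, nonabelian embedding tensors\<close>

text \<open>
  Vector spaces are whole types with an explicit scalar multiplication. In characteristic 0,
  linear maps out of an exterior power of \<open>L\<close> are the same as skew-symmetric multilinear maps
  on \<open>L\<close>; brackets and actions are given in the latter, curried form.
\<close>

locale three_lie_algebra = vector_space scale
  for scale :: "'k::field \<Rightarrow> 'l::ab_group_add \<Rightarrow> 'l" +
  fixes bracket :: "'l \<Rightarrow> 'l \<Rightarrow> 'l \<Rightarrow> 'l"
  assumes bracket_linear1: "Vector_Spaces.linear scale scale (\<lambda>x. bracket x y z)"
    and bracket_linear2: "Vector_Spaces.linear scale scale (\<lambda>y. bracket x y z)"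
    and bracket_linear3: "Vector_Spaces.linear scale scale (\<lambda>z. bracket x y z)"
    and bracket_skew12: "bracket x y z = - bracket y x z"
    and bracket_skew23: "bracket x y z = - bracket x z y"
    and fundamental_identity:
      "bracket l1 l2 (bracket l3 l4 l5) =
         bracket (bracket l1 l2 l3) l4 l5 + bracket l3 (bracket l1 l2 l4) l5
         + bracket l3 l4 (bracket l1 l2 l5)"

locale coherent_action =
  L: three_lie_algebra sL brL + H: three_lie_algebra sH brH
  for sL :: "'k::field \<Rightarrow> 'l::ab_group_add \<Rightarrow> 'l" and brL
    and sH :: "'k \<Rightarrow> 'h::ab_group_add \<Rightarrow> 'h" and brH +
  fixes \<rho> :: "'l \<Rightarrow> 'l \<Rightarrow> 'h \<Rightarrow> 'h"
  assumes action_End: "Vector_Spaces.linear sH sH (\<rho> a b)"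
    and action_linear1: "Vector_Spaces.linear sL sH (\<lambda>a. \<rho> a b u)"
    and action_linear2: "Vector_Spaces.linear sL sH (\<lambda>b. \<rho> a b u)"
    and action_skew: "\<rho> a b u = - \<rho> b a u"
    and action_bracket:
      "\<rho> (brL l1 l2 l3) l4 u =
         \<rho> l2 l3 (\<rho> l1 l4 u) + \<rho> l3 l1 (\<rho> l2 l4 u) + \<rho> l1 l2 (\<rho> l3 l4 u)"
    and action_commute:
      "\<rho> l1 l2 (\<rho> l3 l4 u) =
         \<rho> l3 l4 (\<rho> l1 l2 u) + \<rho> (brL l1 l2 l3) l4 u + \<rho> l3 (brL l1 l2 l4) u"
    and action_derivation:
      "\<rho> l1 l2 (brH h1 h2 h3) =
         brH (\<rho> l1 l2 h1) h2 h3 + brH h1 (\<rho> l1 l2 h2) h3 + brH h1 h2 (\<rho> l1 l2 h3)"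
    and action_coherent: "brH (\<rho> l1 l2 h1) h2 h3 = 0"

locale nonabelian_embedding_tensor = coherent_action sL brL sH brH \<rho>
  for sL :: "'k::field \<Rightarrow> 'l::ab_group_add \<Rightarrow> 'l" and brL
    and sH :: "'k \<Rightarrow> 'h::ab_group_add \<Rightarrow> 'h" and brH and \<rho> +
  fixes \<Lambda> :: "'h \<Rightarrow> 'l"
  assumes tensor_linear: "Vector_Spaces.linear sH sL \<Lambda>"
    and tensor_identity:
      "brL (\<Lambda> h1) (\<Lambda> h2) (\<Lambda> h3) = \<Lambda> (\<rho> (\<Lambda> h1) (\<Lambda> h2) h3 + brH h1 h2 h3)"


section \<open>The exterior square\<close>

text \<open>
  The free vector space on \<open>V \<times> V\<close> consists of the finitely supported functions
  \<open>V \<times> V \<Rightarrow>\<^sub>0 K\<close>; the exterior square is its quotient by the span of the bilinearity and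
  alternation relations, and its elements are cosets.
\<close>

definition free_scale :: "'k::field \<Rightarrow> ('x \<Rightarrow>\<^sub>0 'k) \<Rightarrow> ('x \<Rightarrow>\<^sub>0 'k)" where
  "free_scale c p = Poly_Mapping.map ((*) c) p"

definition wedge_generators ::
  "('k::field \<Rightarrow> 'v::ab_group_add \<Rightarrow> 'v) \<Rightarrow> ('v \<times> 'v \<Rightarrow>\<^sub>0 'k) set" where
  "wedge_generators s =
     {Poly_Mapping.single (a + a', b) 1 - Poly_Mapping.single (a, b) 1
        - Poly_Mapping.single (a', b) 1 | a a' b. True}
   \<union> {Poly_Mapping.single (a, b + b') 1 - Poly_Mapping.single (a, b) 1
        - Poly_Mapping.single (a, b') 1 | a b b'. True}
   \<union> {Poly_Mapping.single (s c a, b) 1 - Poly_Mapping.single (a, b) c | c a b. True}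
   \<union> {Poly_Mapping.single (a, s c b) 1 - Poly_Mapping.single (a, b) c | c a b. True}
   \<union> {Poly_Mapping.single (a, a) 1 | a. True}"

definition wedge_relation ::
  "('k::field \<Rightarrow> 'v::ab_group_add \<Rightarrow> 'v) \<Rightarrow> (('v \<times> 'v \<Rightarrow>\<^sub>0 'k) \<times> ('v \<times> 'v \<Rightarrow>\<^sub>0 'k)) set" where
  "wedge_relation s = {(p, q). p - q \<in> module.span free_scale (wedge_generators s)}"

definition exterior_square ::
  "('k::field \<Rightarrow> 'v::ab_group_add \<Rightarrow> 'v) \<Rightarrow> ('v \<times> 'v \<Rightarrow>\<^sub>0 'k) set set" where
  "exterior_square s = UNIV // wedge_relation s"

definition wedge ::
  "('k::field \<Rightarrow> 'v::ab_group_add \<Rightarrow> 'v) \<Rightarrow> 'v \<Rightarrow> 'v \<Rightarrow> ('v \<times> 'v \<Rightarrow>\<^sub>0 'k) set" where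
  "wedge s a b = wedge_relation s `` {Poly_Mapping.single (a, b) 1}"

definition free_extend ::
  "('k::field \<Rightarrow> 'm::ab_group_add \<Rightarrow> 'm) \<Rightarrow> ('v \<Rightarrow> 'v \<Rightarrow> 'm) \<Rightarrow> ('v \<times> 'v \<Rightarrow>\<^sub>0 'k) \<Rightarrow> 'm" where
  "free_extend s B p =
     (\<Sum>(a, b)\<in>Poly_Mapping.keys p. s (Poly_Mapping.lookup p (a, b)) (B a b))"

text \<open>
  The linear extension to the exterior square of an alternating bilinear map \<open>B\<close>: the common
  value of \<open>free_extend s B\<close> on all representatives (see \<open>wedge_extend_class\<close>
  and \<open>wedge_extend_wedge\<close> below).
\<close>

definition wedge_extend ::
  "('k::field \<Rightarrow> 'm::ab_group_add \<Rightarrow> 'm) \<Rightarrow> ('v \<Rightarrow> 'v \<Rightarrow> 'm) \<Rightarrow> ('v \<times> 'v \<Rightarrow>\<^sub>0 'k) set \<Rightarrow> 'm" where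
  "wedge_extend s B X = (THE m. \<forall>p\<in>X. m = free_extend s B p)"

lemma lookup_free_scale [simp]:
  "Poly_Mapping.lookup (free_scale c p) x = c * Poly_Mapping.lookup p x"
  by (simp add: free_scale_def Poly_Mapping.map.rep_eq when_def)

lemma vector_space_free_scale: "vector_space (free_scale :: 'k::field \<Rightarrow> ('x \<Rightarrow>\<^sub>0 'k) \<Rightarrow> _)"
proof
  fix a b :: 'k and x y :: "'x \<Rightarrow>\<^sub>0 'k"
  show "free_scale a (x + y) = free_scale a x + free_scale a y"
    by (rule poly_mapping_eqI) (simp add: lookup_add distrib_left)
  show "free_scale (a + b) x = free_scale a x + free_scale b x"
    by (rule poly_mapping_eqI) (simp add: lookup_add distrib_right)
  show "free_scale a (free_scale b x) = free_scale (a * b) x"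
    by (rule poly_mapping_eqI) (simp add: mult.assoc)
  show "free_scale 1 x = x"
    by (rule poly_mapping_eqI) simp
qed

lemma free_extend_superset:
  assumes "vector_space s" "finite A" "Poly_Mapping.keys p \<subseteq> A"
  shows "free_extend s B p = (\<Sum>(a, b)\<in>A. s (Poly_Mapping.lookup p (a, b)) (B a b))"
proof -
  interpret vector_space s by fact
  show ?thesis unfolding free_extend_def
    by (rule sum.mono_neutral_left) (use assms in \<open>auto simp: in_keys_iff\<close>)
qed

lemma free_extend_linear:
  fixes s :: "'k::field \<Rightarrow> 'm::ab_group_add \<Rightarrow> 'm" and B :: "'v \<Rightarrow> 'v \<Rightarrow> 'm"
  assumes "vector_space s"
  shows "Vector_Spaces.linear free_scale s (free_extend s B)"
proof -
  interpret vector_space s by fact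
  show ?thesis
  proof (intro Vector_Spaces.linear_iff[THEN iffD2] conjI allI)
    show "vector_space (free_scale :: _ \<Rightarrow> ('v \<times> 'v \<Rightarrow>\<^sub>0 'k) \<Rightarrow> _)"
      by (rule vector_space_free_scale)
    fix p q :: "'v \<times> 'v \<Rightarrow>\<^sub>0 'k"
    let ?A = "Poly_Mapping.keys p \<union> Poly_Mapping.keys q"
    have "Poly_Mapping.keys (p + q) \<subseteq> ?A" by (rule Poly_Mapping.keys_add)
    then show "free_extend s B (p + q) = free_extend s B p + free_extend s B q"
      by (simp add: free_extend_superset[OF assms, of ?A] lookup_add scale_left_distrib
          sum.distrib case_prod_unfold)
  next
    fix c and p :: "'v \<times> 'v \<Rightarrow>\<^sub>0 'k"
    have "Poly_Mapping.keys (free_scale c p) \<subseteq> Poly_Mapping.keys p"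
      by (auto simp: in_keys_iff)
    then show "free_extend s B (free_scale c p) = s c (free_extend s B p)"
      by (simp add: free_extend_superset[OF assms, of "Poly_Mapping.keys p"] scale_sum_right
          case_prod_unfold)
  qed (rule assms)
qed

lemma free_extend_single [simp]:
  assumes "vector_space s"
  shows "free_extend s B (Poly_Mapping.single (a, b) c) = s c (B a b)"
proof -
  interpret vector_space s by fact
  show ?thesis
    by (subst free_extend_superset[OF assms, of "{(a, b)}"]) auto
qed

lemma wedge_extend_class:
  fixes sV :: "'k::field \<Rightarrow> 'v::ab_group_add \<Rightarrow> 'v" and s :: "'k \<Rightarrow> 'm::ab_group_add \<Rightarrow> 'm"
  assumes B1: "\<And>b. Vector_Spaces.linear sV s (\<lambda>a. B a b)"
    and B2: "\<And>a. Vector_Spaces.linear sV s (\<lambda>b. B a b)"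
    and alt: "\<And>a. B a a = 0"
  shows "wedge_extend s B (wedge_relation sV `` {p}) = free_extend s B p"
proof -
  have vs: "vector_space s" using B1 by (simp add: Vector_Spaces.linear_iff)
  interpret vector_space s by fact
  interpret F: vector_space "free_scale :: 'k \<Rightarrow> ('v \<times> 'v \<Rightarrow>\<^sub>0 'k) \<Rightarrow> _"
    by (rule vector_space_free_scale)
  interpret E: Vector_Spaces.linear free_scale s "free_extend s B"
    by (rule free_extend_linear[OF vs])
  have add: "B (a + a') b = B a b + B a' b" "B a (b + b') = B a b + B a b'"
    and scl: "B (sV c a) b = s c (B a b)" "B a (sV c b) = s c (B a b)" for a a' b b' c
    using B1 B2 by (auto simp: Vector_Spaces.linear_iff)
  have "free_extend s B r = 0" if "r \<in> wedge_generators sV" for r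
  proof -
    note that[unfolded wedge_generators_def Un_iff mem_Collect_eq]
    then show ?thesis
      by (elim disjE exE conjE; hypsubst)
        (simp_all only: E.diff free_extend_single[OF vs] add scl alt scale_one
          scale_zero_right add_diff_cancel_left' diff_self)
  qed
  then have ker: "free_extend s B r = 0" if "r \<in> F.span (wedge_generators sV)" for r
    using E.eq_0_on_span[OF _ that] by blast
  have const: "free_extend s B p = free_extend s B q" if "q \<in> wedge_relation sV `` {p}" for q
    using ker[of "p - q"] that by (simp add: wedge_relation_def E.diff)
  have rep: "p \<in> wedge_relation sV `` {p}"
    by (simp add: wedge_relation_def F.span_zero)
  show ?thesis
    unfolding wedge_extend_def
  proof (rule the_equality)
    show "\<forall>q\<in>wedge_relation sV `` {p}. free_extend s B p = free_extend s B q"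
      using const by (rule ballI)
  qed (rule bspec[OF _ rep])
qed

lemma wedge_extend_wedge:
  fixes sV :: "'k::field \<Rightarrow> 'v::ab_group_add \<Rightarrow> 'v" and s :: "'k \<Rightarrow> 'm::ab_group_add \<Rightarrow> 'm"
  assumes "\<And>b. Vector_Spaces.linear sV s (\<lambda>a. B a b)"
    and "\<And>a. Vector_Spaces.linear sV s (\<lambda>b. B a b)"
    and "\<And>a. B a a = 0"
  shows "wedge_extend s B (wedge sV a b) = B a b"
proof -
  have vs: "vector_space s" using assms(1) by (simp add: Vector_Spaces.linear_iff)
  then interpret vector_space s .
  show ?thesis unfolding wedge_def by (simp only: wedge_extend_class[OF assms] free_extend_single[OF vs] scale_one)
qed

definition ad_wedge ::
  "('k::field \<Rightarrow> 'l::ab_group_add \<Rightarrow> 'l) \<Rightarrow> ('l \<Rightarrow> 'l \<Rightarrow> 'l \<Rightarrow> 'l) \<Rightarrow> ('l \<times> 'l \<Rightarrow>\<^sub>0 'k) set \<Rightarrow> 'l \<Rightarrow> 'l" where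
  "ad_wedge sL brL X l = wedge_extend sL (\<lambda>a b. brL a b l) X"

definition action_wedge ::
  "('k::field \<Rightarrow> 'h::ab_group_add \<Rightarrow> 'h) \<Rightarrow> ('l \<Rightarrow> 'l \<Rightarrow> 'h \<Rightarrow> 'h) \<Rightarrow> ('l \<times> 'l \<Rightarrow>\<^sub>0 'k) set \<Rightarrow> 'h \<Rightarrow> 'h" where
  "action_wedge sH \<rho> X u = wedge_extend sH (\<lambda>a b. \<rho> a b u) X"


section \<open>The first cohomology group\<close>

definition descendent_bracket ::
  "('h \<Rightarrow> 'h \<Rightarrow> 'h \<Rightarrow> 'h::ab_group_add) \<Rightarrow> ('l \<Rightarrow> 'l \<Rightarrow> 'h \<Rightarrow> 'h) \<Rightarrow> ('h \<Rightarrow> 'l) \<Rightarrow> 'h \<Rightarrow> 'h \<Rightarrow> 'h \<Rightarrow> 'h" where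
  "descendent_bracket brH \<rho> \<Lambda> h1 h2 h3 = \<rho> (\<Lambda> h1) (\<Lambda> h2) h3 + brH h1 h2 h3"

definition coboundary1 ::
  "('l \<Rightarrow> 'l \<Rightarrow> 'l \<Rightarrow> 'l::ab_group_add) \<Rightarrow> ('h \<Rightarrow> 'h \<Rightarrow> 'h \<Rightarrow> 'h::ab_group_add) \<Rightarrow>
   ('l \<Rightarrow> 'l \<Rightarrow> 'h \<Rightarrow> 'h) \<Rightarrow> ('h \<Rightarrow> 'l) \<Rightarrow> ('h \<Rightarrow> 'l) \<Rightarrow> 'h \<Rightarrow> 'h \<Rightarrow> 'h \<Rightarrow> 'l" where
  "coboundary1 brL brH \<rho> \<Lambda> \<phi> u v w =
     - \<phi> (descendent_bracket brH \<rho> \<Lambda> u v w)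
     + brL (\<Lambda> u) (\<Lambda> v) (\<phi> w)
     + brL (\<Lambda> u) (\<phi> v) (\<Lambda> w) - \<Lambda> (\<rho> (\<Lambda> u) (\<phi> v) w)
     + brL (\<phi> u) (\<Lambda> v) (\<Lambda> w) - \<Lambda> (\<rho> (\<phi> u) (\<Lambda> v) w)"

text \<open>The linear extension with values in \<open>Hom(H, L)\<close> is taken pointwise in \<open>u\<close>.\<close>

definition coboundary0 ::
  "('k::field \<Rightarrow> 'l::ab_group_add \<Rightarrow> 'l) \<Rightarrow> ('l \<Rightarrow> 'l \<Rightarrow> 'l \<Rightarrow> 'l) \<Rightarrow>
   ('l \<Rightarrow> 'l \<Rightarrow> 'h \<Rightarrow> 'h) \<Rightarrow> ('h \<Rightarrow> 'l) \<Rightarrow> ('l \<times> 'l \<Rightarrow>\<^sub>0 'k) set \<Rightarrow> 'h \<Rightarrow> 'l" where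
  "coboundary0 sL brL \<rho> \<Lambda> X u =
     wedge_extend sL (\<lambda>a1 a2. \<Lambda> (\<rho> a1 a2 u) - brL a1 a2 (\<Lambda> u)) X"

definition cocycles1 ::
  "('k::field \<Rightarrow> 'l::ab_group_add \<Rightarrow> 'l) \<Rightarrow> ('l \<Rightarrow> 'l \<Rightarrow> 'l \<Rightarrow> 'l) \<Rightarrow>
   ('k \<Rightarrow> 'h::ab_group_add \<Rightarrow> 'h) \<Rightarrow> ('h \<Rightarrow> 'h \<Rightarrow> 'h \<Rightarrow> 'h) \<Rightarrow>
   ('l \<Rightarrow> 'l \<Rightarrow> 'h \<Rightarrow> 'h) \<Rightarrow> ('h \<Rightarrow> 'l) \<Rightarrow> ('h \<Rightarrow> 'l) set" where
  "cocycles1 sL brL sH brH \<rho> \<Lambda> =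
     {\<phi>. Vector_Spaces.linear sH sL \<phi> \<and> (\<forall>u v w. coboundary1 brL brH \<rho> \<Lambda> \<phi> u v w = 0)}"

definition coboundaries1 ::
  "('k::field \<Rightarrow> 'l::ab_group_add \<Rightarrow> 'l) \<Rightarrow> ('l \<Rightarrow> 'l \<Rightarrow> 'l \<Rightarrow> 'l) \<Rightarrow>
   ('l \<Rightarrow> 'l \<Rightarrow> 'h \<Rightarrow> 'h) \<Rightarrow> ('h \<Rightarrow> 'l) \<Rightarrow> ('h \<Rightarrow> 'l) set" where
  "coboundaries1 sL brL \<rho> \<Lambda> = coboundary0 sL brL \<rho> \<Lambda> ` exterior_square sL"

text \<open>The elements of the first cohomology group are the cosets \<open>\<phi> + B\<^sup>1\<close> with \<open>\<phi> \<in> Z\<^sup>1\<close>.\<close>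

definition cohomology1 ::
  "('k::field \<Rightarrow> 'l::ab_group_add \<Rightarrow> 'l) \<Rightarrow> ('l \<Rightarrow> 'l \<Rightarrow> 'l \<Rightarrow> 'l) \<Rightarrow>
   ('k \<Rightarrow> 'h::ab_group_add \<Rightarrow> 'h) \<Rightarrow> ('h \<Rightarrow> 'h \<Rightarrow> 'h \<Rightarrow> 'h) \<Rightarrow>
   ('l \<Rightarrow> 'l \<Rightarrow> 'h \<Rightarrow> 'h) \<Rightarrow> ('h \<Rightarrow> 'l) \<Rightarrow> ('h \<Rightarrow> 'l) set set" where
  "cohomology1 sL brL sH brH \<rho> \<Lambda> =
     cocycles1 sL brL sH brH \<rho> \<Lambda> //
       {(\<phi>, \<psi>). (\<lambda>u. \<phi> u - \<psi> u) \<in> coboundaries1 sL brL \<rho> \<Lambda>}"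


section \<open>Infinitesimal deformations\<close>

text \<open>
  A pair \<open>(x0, x1)\<close> stands for \<open>x0 + t x1\<close> in \<open>V[t]/(t\<^sup>2)\<close>. The following are the
  inclusion of \<open>V\<close>, the map \<open>f0 + t f1\<close>, and the \<open>K[t]/(t\<^sup>2)\<close>-linear extension of a
  trilinear map.
\<close>

definition dual_const :: "'v \<Rightarrow> 'v \<times> 'v::zero" where
  "dual_const x = (x, 0)"

definition dual_map :: "('v \<Rightarrow> 'w) \<Rightarrow> ('v \<Rightarrow> 'w) \<Rightarrow> 'v \<times> 'v \<Rightarrow> 'w \<times> 'w::ab_group_add" where
  "dual_map f0 f1 = (\<lambda>(x0, x1). (f0 x0, f0 x1 + f1 x0))"

definition dual_trilinear ::
  "('a \<Rightarrow> 'b \<Rightarrow> 'c \<Rightarrow> 'd) \<Rightarrow> 'a \<times> 'a \<Rightarrow> 'b \<times> 'b \<Rightarrow> 'c \<times> 'c \<Rightarrow> 'd \<times> 'd::ab_group_add" where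
  "dual_trilinear F = (\<lambda>(x0, x1) (y0, y1) (z0, z1).
     (F x0 y0 z0, F x1 y0 z0 + F x0 y1 z0 + F x0 y0 z1))"

definition infinitesimal_deformations ::
  "('k::field \<Rightarrow> 'l::ab_group_add \<Rightarrow> 'l) \<Rightarrow> ('l \<Rightarrow> 'l \<Rightarrow> 'l \<Rightarrow> 'l) \<Rightarrow>
   ('k \<Rightarrow> 'h::ab_group_add \<Rightarrow> 'h) \<Rightarrow> ('h \<Rightarrow> 'h \<Rightarrow> 'h \<Rightarrow> 'h) \<Rightarrow>
   ('l \<Rightarrow> 'l \<Rightarrow> 'h \<Rightarrow> 'h) \<Rightarrow> ('h \<Rightarrow> 'l) \<Rightarrow> ('h \<times> 'h \<Rightarrow> 'l \<times> 'l) set" where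
  "infinitesimal_deformations sL brL sH brH \<rho> \<Lambda> =
     {\<Lambda>t. (\<exists>\<Lambda>1. Vector_Spaces.linear sH sL \<Lambda>1 \<and> \<Lambda>t = dual_map \<Lambda> \<Lambda>1) \<and>
        (\<forall>u1 u2 u3.
           dual_trilinear brL (\<Lambda>t (dual_const u1)) (\<Lambda>t (dual_const u2)) (\<Lambda>t (dual_const u3)) =
           \<Lambda>t (dual_trilinear \<rho> (\<Lambda>t (dual_const u1)) (\<Lambda>t (dual_const u2)) (dual_const u3))
           + \<Lambda>t (dual_const (brH u1 u2 u3)))}"

definition preserves_bracket ::
  "('v \<Rightarrow> 'v \<Rightarrow> 'v \<Rightarrow> 'v) \<Rightarrow> ('w \<Rightarrow> 'w \<Rightarrow> 'w \<Rightarrow> 'w) \<Rightarrow> ('v \<Rightarrow> 'w) \<Rightarrow> bool" where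
  "preserves_bracket br br' f \<longleftrightarrow> (\<forall>x y z. f (br x y z) = br' (f x) (f y) (f z))"

definition equivalent_deformations ::
  "('k::field \<Rightarrow> 'l::ab_group_add \<Rightarrow> 'l) \<Rightarrow> ('l \<Rightarrow> 'l \<Rightarrow> 'l \<Rightarrow> 'l) \<Rightarrow>
   ('k \<Rightarrow> 'h::ab_group_add \<Rightarrow> 'h) \<Rightarrow> ('h \<Rightarrow> 'h \<Rightarrow> 'h \<Rightarrow> 'h) \<Rightarrow>
   ('l \<Rightarrow> 'l \<Rightarrow> 'h \<Rightarrow> 'h) \<Rightarrow> ('h \<times> 'h \<Rightarrow> 'l \<times> 'l) \<Rightarrow> ('h \<times> 'h \<Rightarrow> 'l \<times> 'l) \<Rightarrow> bool" where
  "equivalent_deformations sL brL sH brH \<rho> \<Lambda>t \<Lambda>t' \<longleftrightarrow>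
     (\<exists>X\<in>exterior_square sL.
        let fL = dual_map id (ad_wedge sL brL X);
            fH = dual_map id (action_wedge sH \<rho> X)
        in preserves_bracket (dual_trilinear brL) (dual_trilinear brL) fL
         \<and> preserves_bracket (dual_trilinear brH) (dual_trilinear brH) fH
         \<and> (\<forall>a b u. fH (dual_const (\<rho> a b u)) =
              dual_trilinear \<rho> (fL (dual_const a)) (fL (dual_const b)) (fH (dual_const u)))
         \<and> \<Lambda>t' \<circ> fH = fL \<circ> \<Lambda>t)"

definition deformation_classes ::
  "('k::field \<Rightarrow> 'l::ab_group_add \<Rightarrow> 'l) \<Rightarrow> ('l \<Rightarrow> 'l \<Rightarrow> 'l \<Rightarrow> 'l) \<Rightarrow>
   ('k \<Rightarrow> 'h::ab_group_add \<Rightarrow> 'h) \<Rightarrow> ('h \<Rightarrow> 'h \<Rightarrow> 'h \<Rightarrow> 'h) \<Rightarrow>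
   ('l \<Rightarrow> 'l \<Rightarrow> 'h \<Rightarrow> 'h) \<Rightarrow> ('h \<Rightarrow> 'l) \<Rightarrow> ('h \<times> 'h \<Rightarrow> 'l \<times> 'l) set set" where
  "deformation_classes sL brL sH brH \<rho> \<Lambda> =
     infinitesimal_deformations sL brL sH brH \<rho> \<Lambda> //
       {(\<Lambda>t, \<Lambda>t'). \<Lambda>t \<in> infinitesimal_deformations sL brL sH brH \<rho> \<Lambda>
          \<and> \<Lambda>t' \<in> infinitesimal_deformations sL brL sH brH \<rho> \<Lambda>
          \<and> equivalent_deformations sL brL sH brH \<rho> \<Lambda>t \<Lambda>t'}"

end

theory Submission
  imports Defs
begin

text \<open>
  The coefficient of \<open>t\<close> in the defining identity of a deformation \<open>\<Lambda> + t \<phi>\<close> is the cocycle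
  condition on \<open>\<phi>\<close>. For every \<open>X\<close> in the exterior square, \<open>ad(X)\<close> and \<open>\<rho>(X)\<close> are derivations
  of the brackets and of the action, so the homomorphism conditions in the definition of
  equivalence hold automatically modulo \<open>t\<^sup>2\<close>. What remains is
  \<open>\<Lambda>' \<circ> f\<^sub>H = f\<^sub>L \<circ> \<Lambda>\<close>, whose coefficient of \<open>t\<close> says that the difference of the two cocycles
  is the coboundary of \<open>X\<close>.
\<close>

section \<open>Bijections between quotients\<close>

text \<open>\<open>R\<close> lives on the whole type, so its classes may leave \<open>Z\<close>;
  intersecting with \<open>Z\<close> makes \<open>g\<close> carry the class of \<open>x\<close>
  exactly onto the \<open>S\<close>-class of \<open>g x\<close>.\<close>

lemma quotient_bij_betw:
  assumes g: "bij_betw g Z D"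
    and R: "equiv UNIV R"
    and S: "S \<subseteq> D \<times> D"
    and RS: "\<And>x y. x \<in> Z \<Longrightarrow> y \<in> Z \<Longrightarrow> (g x, g y) \<in> S \<longleftrightarrow> (x, y) \<in> R"
  shows "bij_betw (\<lambda>C. g ` (C \<inter> Z)) (Z // R) (D // S)"
proof -
  have D: "D = g ` Z" using g by (simp add: bij_betw_def)
  have cls: "g ` (R `` {x} \<inter> Z) = S `` {g x}" if "x \<in> Z" for x
    using that RS S unfolding D by blast
  show ?thesis
  proof (rule bij_betw_imageI)
    show "inj_on (\<lambda>C. g ` (C \<inter> Z)) (Z // R)"
    proof (rule inj_onI)
      fix C C' assume "C \<in> Z // R" "C' \<in> Z // R" and eq: "g ` (C \<inter> Z) = g ` (C' \<inter> Z)"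
      then obtain x y where x: "x \<in> Z" "C = R `` {x}" and y: "y \<in> Z" "C' = R `` {y}"
        by (auto elim!: quotientE)
      \<comment> \<open>Reflexivity puts \<open>y\<close> into \<open>C' \<inter> Z\<close>, so
        \<open>g y\<close> lies in the common image, which is the \<open>S\<close>-class of
        \<open>g x\<close>.\<close>
      have "(y, y) \<in> R" using R by (simp add: equiv_def refl_on_def)
      then have "(g x, g y) \<in> S" using eq x y cls RS by blast
      then have "(x, y) \<in> R" using RS x y by blast
      then show "C = C'" using x y equiv_class_eq[OF R] by blast
    qed
    show "(\<lambda>C. g ` (C \<inter> Z)) ` (Z // R) = D // S"
      using cls by (auto simp: quotient_def D image_iff)
  qed
qed

section \<open>Alternation and linear extension\<close>

text \<open>Turns skew-symmetry into alternation.\<close>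

lemma (in vector_space) eq_minus_self_iff:
  fixes x :: 'b
  assumes "(2::'a) \<noteq> 0"
  shows "x = - x \<longleftrightarrow> x = 0"
proof
  assume "x = - x"
  then have "x + x = 0" by (metis add.right_inverse)
  moreover have "x + x = scale 2 x"
    by (metis one_add_one scale_left_distrib scale_one)
  ultimately show "x = 0" using assms by simp
qed simp

text \<open>With the next two lemmas, collects both sides of an identity into single extensions, so
  that it need only be checked on pairs \<open>(a, b)\<close>.\<close>

lemma linear_free_extend:
  assumes "Vector_Spaces.linear s s' T"
  shows "T (free_extend s B p) = free_extend s' (\<lambda>a b. T (B a b)) p"
proof -
  interpret Vector_Spaces.linear s s' T by fact
  show ?thesis by (simp add: free_extend_def sum scale case_prod_unfold)
qed

lemma free_extend_add:
  assumes "vector_space s"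
  shows "free_extend s (\<lambda>a b. B a b + C a b) p = free_extend s B p + free_extend s C p"
proof -
  interpret vector_space s by fact
  show ?thesis
    by (simp add: free_extend_def scale_right_distrib sum.distrib case_prod_unfold)
qed

lemma free_extend_diff:
  assumes "vector_space s"
  shows "free_extend s (\<lambda>a b. B a b - C a b) p = free_extend s B p - free_extend s C p"
proof -
  interpret vector_space s by fact
  show ?thesis
    by (simp add: free_extend_def scale_right_diff_distrib sum_subtractf case_prod_unfold)
qed

context three_lie_algebra
begin

lemmas bracket_add =
  module_hom.add[OF Vector_Spaces.linear.axioms(3)[OF bracket_linear1]]
  module_hom.add[OF Vector_Spaces.linear.axioms(3)[OF bracket_linear2]]
  module_hom.add[OF Vector_Spaces.linear.axioms(3)[OF bracket_linear3]]

text \<open>The coefficient of \<open>t\<close> in the homomorphism condition is the Leibniz rule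
  for \<open>D\<close>.\<close>

lemma preserves_bracket_dual_map_derivation:
  assumes "\<And>x y z. D (bracket x y z) = bracket (D x) y z + bracket x (D y) z + bracket x y (D z)"
  shows "preserves_bracket (dual_trilinear bracket) (dual_trilinear bracket) (dual_map id D)"
  by (auto simp: preserves_bracket_def dual_map_def dual_trilinear_def assms bracket_add
      algebra_simps)

end

lemma dual_map_cancel: "dual_map f0 f = dual_map f0 g \<longleftrightarrow> f = g"
  by (auto simp: dual_map_def fun_eq_iff)

section \<open>Evaluation on representatives\<close>

locale nonabelian_embedding_tensor_char_0 = nonabelian_embedding_tensor sL brL sH brH \<rho> \<Lambda>
  for sL :: "'k::field_char_0 \<Rightarrow> 'l::ab_group_add \<Rightarrow> 'l" and brL
    and sH :: "'k \<Rightarrow> 'h::ab_group_add \<Rightarrow> 'h" and brH and \<rho> and \<Lambda>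
begin

sublocale tensor: Vector_Spaces.linear sH sL \<Lambda>
  by (rule tensor_linear)

lemma action_zero: "\<rho> a b 0 = 0"
  by (rule module_hom.zero[OF Vector_Spaces.linear.axioms(3)[OF action_End]])

lemma bracket_alternating: "brL a a l = 0"
  using L.bracket_skew12[of a a l] L.eq_minus_self_iff by simp

lemma action_alternating: "\<rho> a a u = 0"
  using action_skew[of a a u] H.eq_minus_self_iff by simp

text \<open>Takes a representative in the free vector space, so that computations avoid
  cosets.\<close>

definition ad :: "('l \<times> 'l \<Rightarrow>\<^sub>0 'k) \<Rightarrow> 'l \<Rightarrow> 'l" where
  "ad p l = free_extend sL (\<lambda>a b. brL a b l) p"

definition act :: "('l \<times> 'l \<Rightarrow>\<^sub>0 'k) \<Rightarrow> 'h \<Rightarrow> 'h" where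
  "act p u = free_extend sH (\<lambda>a b. \<rho> a b u) p"

lemma ad_wedge_class: "ad_wedge sL brL (wedge_relation sL `` {p}) = ad p"
  by (rule ext) (simp add: ad_wedge_def ad_def wedge_extend_class L.bracket_linear1
      L.bracket_linear2 bracket_alternating)

lemma action_wedge_class: "action_wedge sH \<rho> (wedge_relation sL `` {p}) = act p"
  by (rule ext) (simp add: action_wedge_def act_def wedge_extend_class[where sV = sL]
      action_linear1 action_linear2 action_alternating)

text \<open>The integrand is bilinear and alternating, so its extension may be evaluated on
  \<open>p\<close>, where it splits and \<open>\<Lambda>\<close> moves out of the sum.\<close>

lemma coboundary0_class:
  "coboundary0 sL brL \<rho> \<Lambda> (wedge_relation sL `` {p}) u = \<Lambda> (act p u) - ad p (\<Lambda> u)"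
proof -
  let ?B = "\<lambda>a b. \<Lambda> (\<rho> a b u) - brL a b (\<Lambda> u)"
  have "Vector_Spaces.linear sL sL (\<lambda>a. ?B a b)" for b
    using Vector_Spaces.linear_compose[OF action_linear1 tensor_linear] L.bracket_linear1
    by (intro vector_space_pair.linear_compose_sub)
      (simp_all add: o_def Vector_Spaces.linear_iff vector_space_pair_def)
  moreover have "Vector_Spaces.linear sL sL (\<lambda>b. ?B a b)" for a
    using Vector_Spaces.linear_compose[OF action_linear2 tensor_linear] L.bracket_linear2
    by (intro vector_space_pair.linear_compose_sub)
      (simp_all add: o_def Vector_Spaces.linear_iff vector_space_pair_def)
  ultimately have "coboundary0 sL brL \<rho> \<Lambda> (wedge_relation sL `` {p}) u = free_extend sL ?B p"
    unfolding coboundary0_def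
    by (intro wedge_extend_class) (simp_all add: bracket_alternating action_alternating tensor.zero)
  then show ?thesis
    by (simp add: free_extend_diff[OF L.vector_space_axioms] act_def ad_def
        linear_free_extend[OF tensor_linear])
qed

lemma exterior_square_eq: "exterior_square sL = range (\<lambda>p. wedge_relation sL `` {p})"
  by (auto simp: exterior_square_def quotient_def)

lemma coboundaries1_eq:
  "coboundaries1 sL brL \<rho> \<Lambda> = range (\<lambda>p u. \<Lambda> (act p u) - ad p (\<Lambda> u))"
  unfolding coboundaries1_def exterior_square_eq image_image
  by (intro image_cong ext refl coboundary0_class)

text \<open>The coboundaries form an additive subgroup, since \<open>act\<close> and
  \<open>ad\<close> are additive in the representative.\<close>

lemma equiv_cohomologous:
  "equiv UNIV {(\<phi>, \<psi>). (\<lambda>u. \<phi> u - \<psi> u) \<in> coboundaries1 sL brL \<rho> \<Lambda>}"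
proof -
  interpret F: vector_space "free_scale :: 'k \<Rightarrow> ('l \<times> 'l \<Rightarrow>\<^sub>0 'k) \<Rightarrow> _"
    by (rule vector_space_free_scale)
  note FL = free_extend_linear[OF L.vector_space_axioms, THEN Vector_Spaces.linear.axioms(3)]
    and FH = free_extend_linear[OF H.vector_space_axioms, THEN Vector_Spaces.linear.axioms(3)]
  have zero: "(\<lambda>u. 0) \<in> coboundaries1 sL brL \<rho> \<Lambda>"
    unfolding coboundaries1_eq
    by (rule range_eqI[of _ _ 0])
      (simp add: act_def ad_def module_hom.zero[OF FL] module_hom.zero[OF FH] tensor.zero)
  have diff: "(\<lambda>u. \<phi> u - \<psi> u) \<in> coboundaries1 sL brL \<rho> \<Lambda>"
    if \<phi>: "\<phi> \<in> coboundaries1 sL brL \<rho> \<Lambda>" and \<psi>: "\<psi> \<in> coboundaries1 sL brL \<rho> \<Lambda>" for \<phi> \<psi>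
  proof -
    obtain p where p: "\<phi> = (\<lambda>u. \<Lambda> (act p u) - ad p (\<Lambda> u))"
      using \<phi> unfolding coboundaries1_eq by blast
    obtain q where q: "\<psi> = (\<lambda>u. \<Lambda> (act q u) - ad q (\<Lambda> u))"
      using \<psi> unfolding coboundaries1_eq by blast
    show ?thesis unfolding coboundaries1_eq p q
      by (rule range_eqI[of _ _ "p - q"])
        (simp add: act_def ad_def module_hom.diff[OF FL] module_hom.diff[OF FH] tensor.diff
          algebra_simps)
  qed
  show ?thesis
  proof (rule equivI)
    show "refl {(\<phi>, \<psi>). (\<lambda>u. \<phi> u - \<psi> u) \<in> coboundaries1 sL brL \<rho> \<Lambda>}"
      using zero by (simp add: refl_on_def)
    show "sym {(\<phi>, \<psi>). (\<lambda>u. \<phi> u - \<psi> u) \<in> coboundaries1 sL brL \<rho> \<Lambda>}"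
      using diff[OF zero] by (force simp: sym_def)
    show "trans {(\<phi>, \<psi>). (\<lambda>u. \<phi> u - \<psi> u) \<in> coboundaries1 sL brL \<rho> \<Lambda>}"
    proof (rule transI, clarsimp)
      fix \<phi> \<psi> \<chi>
      assume 1: "(\<lambda>u. \<phi> u - \<psi> u) \<in> coboundaries1 sL brL \<rho> \<Lambda>"
        and 2: "(\<lambda>u. \<psi> u - \<chi> u) \<in> coboundaries1 sL brL \<rho> \<Lambda>"
      show "(\<lambda>u. \<phi> u - \<chi> u) \<in> coboundaries1 sL brL \<rho> \<Lambda>"
        using diff[OF 1 diff[OF zero 2]] by simp
    qed
  qed simp
qed

section \<open>Derivations from the exterior square\<close>

text \<open>For a single pair this is the fundamental identity; both sides extend linearly.\<close>

lemma ad_derivation: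
  "ad p (brL x y z) = brL (ad p x) y z + brL x (ad p y) z + brL x y (ad p z)"
  unfolding ad_def linear_free_extend[OF L.bracket_linear1] linear_free_extend[OF L.bracket_linear2]
    linear_free_extend[OF L.bracket_linear3] free_extend_add[OF L.vector_space_axioms, symmetric]
  by (simp only: L.fundamental_identity[of _ _ x y z])

lemma act_derivation:
  "act p (brH x y z) = brH (act p x) y z + brH x (act p y) z + brH x y (act p z)"
  unfolding act_def linear_free_extend[OF H.bracket_linear1] linear_free_extend[OF H.bracket_linear2]
    linear_free_extend[OF H.bracket_linear3] free_extend_add[OF H.vector_space_axioms, symmetric]
  by (simp only: action_derivation[of _ _ x y z])

text \<open>The commutation axiom of the action, read as a Leibniz rule and extended
  linearly.\<close>

lemma act_action:
  "act p (\<rho> x y u) = \<rho> (ad p x) y u + \<rho> x (ad p y) u + \<rho> x y (act p u)"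
  unfolding act_def ad_def linear_free_extend[OF action_linear1]
    linear_free_extend[OF action_linear2] linear_free_extend[OF action_End]
    free_extend_add[OF H.vector_space_axioms, symmetric]
  by (simp only: action_commute[of _ _ x y u] ac_simps)

lemma dual_action_equivariant:
  "dual_map id (act p) (dual_const (\<rho> a b u)) =
     dual_trilinear \<rho> (dual_map id (ad p) (dual_const a)) (dual_map id (ad p) (dual_const b))
       (dual_map id (act p) (dual_const u))"
  by (simp add: dual_map_def dual_const_def dual_trilinear_def act_action)

section \<open>Deformations and cocycles\<close>

lemma equivalent_deformations_iff:
  "equivalent_deformations sL brL sH brH \<rho> (dual_map \<Lambda> \<phi>) (dual_map \<Lambda> \<psi>) \<longleftrightarrow>
     (\<lambda>u. \<phi> u - \<psi> u) \<in> coboundaries1 sL brL \<rho> \<Lambda>"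
proof -
  \<comment> \<open>At \<open>u + t v\<close> the constant terms and the summands
    \<open>\<Lambda> v\<close> agree; what is left is \<open>\<Lambda> (act p u) + \<psi> u = \<phi>
    u + ad p (\<Lambda> u)\<close>.\<close>
  have "dual_map \<Lambda> \<psi> \<circ> dual_map id (act p) = dual_map id (ad p) \<circ> dual_map \<Lambda> \<phi> \<longleftrightarrow>
      (\<forall>u. \<phi> u - \<psi> u = \<Lambda> (act p u) - ad p (\<Lambda> u))" for p
    by (auto simp: fun_eq_iff dual_map_def tensor.add algebra_simps)
  then show ?thesis
    by (simp add: equivalent_deformations_def exterior_square_eq coboundaries1_eq Let_def
        ad_wedge_class action_wedge_class dual_action_equivariant image_iff fun_eq_iff[of "\<lambda>u. _ u - _ u"]
        L.preserves_bracket_dual_map_derivation[OF ad_derivation]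
        H.preserves_bracket_dual_map_derivation[OF act_derivation])
qed

lemma deformation_iff_cocycle:
  "dual_map \<Lambda> \<phi> \<in> infinitesimal_deformations sL brL sH brH \<rho> \<Lambda> \<longleftrightarrow>
     \<phi> \<in> cocycles1 sL brL sH brH \<rho> \<Lambda>"
proof (cases "Vector_Spaces.linear sH sL \<phi>")
  case True
  then interpret \<phi>: Vector_Spaces.linear sH sL \<phi> .
  have "dual_trilinear brL (dual_map \<Lambda> \<phi> (dual_const u)) (dual_map \<Lambda> \<phi> (dual_const v))
          (dual_map \<Lambda> \<phi> (dual_const w)) =
        dual_map \<Lambda> \<phi> (dual_trilinear \<rho> (dual_map \<Lambda> \<phi> (dual_const u))
          (dual_map \<Lambda> \<phi> (dual_const v)) (dual_const w))
        + dual_map \<Lambda> \<phi> (dual_const (brH u v w)) \<longleftrightarrow>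
      coboundary1 brL brH \<rho> \<Lambda> \<phi> u v w = 0" (is "?lhs u v w \<longleftrightarrow> ?rhs u v w") for u v w
  proof -
    \<comment> \<open>Rearranges the coefficient of \<open>t\<close> into the order of summands in
      \<open>coboundary1\<close>; \<open>f + g\<close> is \<open>\<phi>\<close> of the descendent
      bracket.\<close>
    have key: "a + b + c = d + e + f + g \<longleftrightarrow> - (f + g) + c + b - e + a - d = 0"
      for a b c d e f g :: 'l
      unfolding eq_iff_diff_eq_0[of "a + b + c"] by (simp add: algebra_simps del: diff_eq_eq)
    \<comment> \<open>The constant coefficients agree by \<open>tensor_identity\<close>.\<close>
    have "?lhs u v w \<longleftrightarrow>
        brL (\<phi> u) (\<Lambda> v) (\<Lambda> w) + brL (\<Lambda> u) (\<phi> v) (\<Lambda> w) + brL (\<Lambda> u) (\<Lambda> v) (\<phi> w) =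
        \<Lambda> (\<rho> (\<phi> u) (\<Lambda> v) w) + \<Lambda> (\<rho> (\<Lambda> u) (\<phi> v) w) + \<phi> (\<rho> (\<Lambda> u) (\<Lambda> v) w) + \<phi> (brH u v w)"
      by (simp add: dual_map_def dual_const_def dual_trilinear_def tensor_identity action_zero
          tensor.add)
    also have "\<dots> \<longleftrightarrow> ?rhs u v w"
      by (simp only: coboundary1_def descendent_bracket_def \<phi>.add key)
    finally show ?thesis .
  qed
  with True show ?thesis
    by (auto simp: infinitesimal_deformations_def cocycles1_def)
\<comment> \<open>By \<open>dual_map_cancel\<close>, \<open>\<phi>\<close> is the only possible
  coefficient of \<open>t\<close>, so both sides fail.\<close>
next
  case False
  then show ?thesis
    by (auto simp: infinitesimal_deformations_def cocycles1_def dual_map_cancel)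
qed

section \<open>Bijections on classes\<close>

lemma bij_betw_cocycles_deformations:
  "bij_betw (dual_map \<Lambda>) (cocycles1 sL brL sH brH \<rho> \<Lambda>)
     (infinitesimal_deformations sL brL sH brH \<rho> \<Lambda>)"
proof (rule bij_betw_imageI)
  show "inj_on (dual_map \<Lambda>) (cocycles1 sL brL sH brH \<rho> \<Lambda>)"
    by (simp add: inj_on_def dual_map_cancel)
  have "\<exists>\<phi>. \<Lambda>t = dual_map \<Lambda> \<phi>" if "\<Lambda>t \<in> infinitesimal_deformations sL brL sH brH \<rho> \<Lambda>" for \<Lambda>t
    using that by (auto simp: infinitesimal_deformations_def)
  then show "dual_map \<Lambda> ` cocycles1 sL brL sH brH \<rho> \<Lambda> =
      infinitesimal_deformations sL brL sH brH \<rho> \<Lambda>"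
    using deformation_iff_cocycle by blast
qed

lemma bij_betw_cohomology1_deformation_classes:
  "bij_betw (\<lambda>C. dual_map \<Lambda> ` (C \<inter> cocycles1 sL brL sH brH \<rho> \<Lambda>))
     (cohomology1 sL brL sH brH \<rho> \<Lambda>) (deformation_classes sL brL sH brH \<rho> \<Lambda>)"
  unfolding cohomology1_def deformation_classes_def
  by (rule quotient_bij_betw[OF bij_betw_cocycles_deformations equiv_cohomologous])
    (auto simp: deformation_iff_cocycle equivalent_deformations_iff)

end

theorem theorem4p7:
  fixes sL :: "'k::field_char_0 \<Rightarrow> 'l::ab_group_add \<Rightarrow> 'l"
    and brL :: "'l \<Rightarrow> 'l \<Rightarrow> 'l \<Rightarrow> 'l"
    and sH :: "'k \<Rightarrow> 'h::ab_group_add \<Rightarrow> 'h"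
    and brH :: "'h \<Rightarrow> 'h \<Rightarrow> 'h \<Rightarrow> 'h"
    and \<rho> :: "'l \<Rightarrow> 'l \<Rightarrow> 'h \<Rightarrow> 'h"
    and \<Lambda> :: "'h \<Rightarrow> 'l"
  assumes "three_lie_algebra sL brL"
    and "three_lie_algebra sH brH"
    and "coherent_action sL brL sH brH \<rho>"
    and "nonabelian_embedding_tensor sL brL sH brH \<rho> \<Lambda>"
  shows "\<exists>f. bij_betw f (deformation_classes sL brL sH brH \<rho> \<Lambda>)
                         (cohomology1 sL brL sH brH \<rho> \<Lambda>)"
proof -
  interpret nonabelian_embedding_tensor_char_0 sL brL sH brH \<rho> \<Lambda>
    using assms(4) by (rule nonabelian_embedding_tensor_char_0.intro)
  show ?thesis
    \<comment> \<open>The bijection was built starting from cohomology, where the relation is known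
      to be an equivalence; its inverse is the witness.\<close>
    by (rule exI, rule bij_betw_inv_into) (rule bij_betw_cohomology1_deformation_classes)
qed

end
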